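(* Let $f:\mathbb{C}\to\mathbb{C}$ be a transcendental entire function such that, for some $r(f)>1$, $$m(r)\le M(r)^{1-K/\log r},\quad\text{for all } r\ge r(f),$$ where $K=4\log 4$. Then $f$ is weakly regular, and hence $Q(f)=A(f)$.
   Context: Here $\mathbb{N}=\{1,2,\dots\}$ and $f^n$ denotes the $n$th iterate of $f$. For $r>0$ put $M(r)=M(r,f)=\max_{|z|=r}|f(z)|$ and $m(r)=m(r,f)=\min_{|z|=r}|f(z)|$, and let $M^n(r)$ denote the $n$th iterate of the function $M$. For $0<\varepsilon<1$ put $\mu_\varepsilon(r)=M(r)^\varepsilon$, $r>0$, with iterates $\mu_\varepsilon^n$. The fast escaping set is $$A(f)=\{z\in\mathbb{C}:\text{there exists }\ell\in\mathbb{N}\text{ such that }|f^{n+\ell}(z)|\ge M^n(R)\text{ for all }n\in\mathbb{N}\},$$ where $R>0$ is any value such that $M(r)>r$ for $r\ge R$. For $0<\varepsilon<1$, $$Q_\varepsilon(f)=\{z\in\mathbb{C}:\text{there exists }\ell\in\mathbb{N}\text{ such that }|f^{n+\ell}(z)|\ge \mu_\varepsilon^n(R)\text{ for all }n\in\mathbb{N}\},$$ where $R>0$ is any value such that $\mu_\varepsilon(r)>r$ for $r\ge R$. These definitions do not depend on the choice of such $R$. The quite fast escaping set is $Q(f)=\bigcup_{0<\varepsilon<1}Q_\varepsilon(f)$. Let $R>0$ be any value such that $M(r)>r$ for $r\ge R$. The function $f$ is $\varepsilon$-regular ($0<\varepsilon<1$) if there exists $r=r(R)>0$ such that $\mu_\varepsilon^n(r)\ge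 M^n(R)$ for all $n\in\mathbb{N}$ (this does not depend on the choice of such $R$). The function $f$ is weakly regular if it is $\varepsilon$-regular for every $\varepsilon\in(0,1)$. *)

theory Defs
  imports "HOL-Complex_Analysis.Complex_Analysis"
begin

definition transcendental_entire :: "(complex \<Rightarrow> complex) \<Rightarrow> bool" where
  "transcendental_entire f \<longleftrightarrow>
     f holomorphic_on UNIV \<and> \<not> (\<exists>p :: complex poly. \<forall>z. f z = poly p z)"

text \<open>For continuous \<open>f\<close> and \<open>r > 0\<close> the supremum and the infimum below are attained;
  see \<open>max_mod_attained\<close> and \<open>min_mod_attained\<close>.\<close>

definition max_mod :: "(complex \<Rightarrow> complex) \<Rightarrow> real \<Rightarrow> real" where
  "max_mod f r = (SUP z\<in>sphere 0 r. norm (f z))"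

definition min_mod :: "(complex \<Rightarrow> complex) \<Rightarrow> real \<Rightarrow> real" where
  "min_mod f r = (INF z\<in>sphere 0 r. norm (f z))"

definition mu :: "(complex \<Rightarrow> complex) \<Rightarrow> real \<Rightarrow> real \<Rightarrow> real" where
  "mu f \<epsilon> r = max_mod f r powr \<epsilon>"

text \<open>The escaping sets and regularity below depend on an auxiliary radius \<open>R\<close>, any
  admissible value of which may be used. The radius is kept as an explicit parameter, so that
  theorems can be stated for every admissible choice. Admissible radii exist whenever \<open>f\<close> is
  transcendental entire; see \<open>admissible_max_mod_exists\<close> and \<open>admissible_mu_exists\<close>.\<close>

definition admissible :: "(real \<Rightarrow> real) \<Rightarrow> real \<Rightarrow> bool" where
  "admissible \<phi> R \<longleftrightarrow> R > 0 \<and> (\<forall>r\<ge>R. \<phi> r > r)"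

text \<open>Here the set of natural numbers starts at 1, whence the bounds on \<open>l\<close> and \<open>n\<close>.\<close>

definition fast_escaping_set :: "(complex \<Rightarrow> complex) \<Rightarrow> real \<Rightarrow> complex set" where
  "fast_escaping_set f R =
     {z. \<exists>l::nat\<ge>1. \<forall>n::nat\<ge>1. norm ((f ^^ (n + l)) z) \<ge> (max_mod f ^^ n) R}"

definition eps_fast_escaping_set :: "(complex \<Rightarrow> complex) \<Rightarrow> real \<Rightarrow> real \<Rightarrow> complex set" where
  "eps_fast_escaping_set f \<epsilon> R =
     {z. \<exists>l::nat\<ge>1. \<forall>n::nat\<ge>1. norm ((f ^^ (n + l)) z) \<ge> (mu f \<epsilon> ^^ n) R}"

text \<open>The admissible radius for \<open>mu f \<epsilon>\<close> may vary with \<open>\<epsilon>\<close>, so here \<open>S\<close> is a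
  function of \<open>\<epsilon>\<close>.\<close>

definition quite_fast_escaping_set :: "(complex \<Rightarrow> complex) \<Rightarrow> (real \<Rightarrow> real) \<Rightarrow> complex set" where
  "quite_fast_escaping_set f S = (\<Union>\<epsilon>\<in>{0<..<1}. eps_fast_escaping_set f \<epsilon> (S \<epsilon>))"

definition eps_regular :: "(complex \<Rightarrow> complex) \<Rightarrow> real \<Rightarrow> real \<Rightarrow> bool" where
  "eps_regular f \<epsilon> R \<longleftrightarrow>
     (\<exists>r>0. \<forall>n::nat\<ge>1. (mu f \<epsilon> ^^ n) r \<ge> (max_mod f ^^ n) R)"

definition weakly_regular :: "(complex \<Rightarrow> complex) \<Rightarrow> real \<Rightarrow> bool" where
  "weakly_regular f R \<longleftrightarrow> (\<forall>\<epsilon>\<in>{0<..<1}. eps_regular f \<epsilon> R)"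

lemma max_mod_attained:
  assumes "continuous_on UNIV f" "r > 0"
  shows "\<exists>z\<in>sphere 0 r. norm (f z) = max_mod f r \<and> (\<forall>w\<in>sphere 0 r. norm (f w) \<le> norm (f z))"
proof -
  have "continuous_on (sphere 0 r) (\<lambda>z. norm (f z))"
    by (intro continuous_on_norm continuous_on_subset[OF assms(1)]) auto
  moreover have "sphere (0::complex) r \<noteq> {}" using assms(2) by simp
  ultimately obtain z where z: "z \<in> sphere 0 r" "\<forall>w\<in>sphere 0 r. norm (f w) \<le> norm (f z)"
    using continuous_attains_sup[of "sphere 0 r" "\<lambda>z. norm (f z)"] by auto
  have "max_mod f r = norm (f z)"
    unfolding max_mod_def using z by (intro cSup_eq_maximum) auto
  then show ?thesis using z by metis
qed

lemma min_mod_attained: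
  assumes "continuous_on UNIV f" "r > 0"
  shows "\<exists>z\<in>sphere 0 r. norm (f z) = min_mod f r \<and> (\<forall>w\<in>sphere 0 r. norm (f z) \<le> norm (f w))"
proof -
  have "continuous_on (sphere 0 r) (\<lambda>z. norm (f z))"
    by (intro continuous_on_norm continuous_on_subset[OF assms(1)]) auto
  moreover have "sphere (0::complex) r \<noteq> {}" using assms(2) by simp
  ultimately obtain z where z: "z \<in> sphere 0 r" "\<forall>w\<in>sphere 0 r. norm (f z) \<le> norm (f w)"
    using continuous_attains_inf[of "sphere 0 r" "\<lambda>z. norm (f z)"] by auto
  have "min_mod f r = norm (f z)"
    unfolding min_mod_def using z by (intro cInf_eq_minimum) auto
  then show ?thesis using z by metis
qed

lemma admissible_mu_exists_aux:
  assumes f: "transcendental_entire f" and e: "\<epsilon> > 0"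
  shows "\<exists>R. admissible (mu f \<epsilon>) R"
proof (rule ccontr)
  assume "\<not> ?thesis"
  then have na: "\<exists>r\<ge>R. mu f \<epsilon> r \<le> r" if "R > 0" for R
    using that unfolding admissible_def by (metis not_less)
  have hol: "f holomorphic_on UNIV" using f by (simp add: transcendental_entire_def)
  then have cont: "continuous_on UNIV f" by (rule holomorphic_on_imp_continuous_on)
  obtain k :: nat where k: "1 / \<epsilon> \<le> real k" using real_arch_simple by blast
  have deriv0: "(deriv ^^ n) f 0 = 0" if n: "n > k" for n
  proof (rule ccontr)
    assume "(deriv ^^ n) f 0 \<noteq> 0"
    then have d: "norm ((deriv ^^ n) f 0) > 0" (is "?d > 0") by simp
    define R where "R = max 1 (fact n / ?d + 1)"
    have "R \<ge> 1" unfolding R_def by simp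
    then obtain r where r: "r \<ge> R" "mu f \<epsilon> r \<le> r" using na[of R] by auto
    have r1: "r \<ge> 1" using r(1) \<open>R \<ge> 1\<close> by linarith
    have rd: "r > fact n / ?d" using r(1) unfolding R_def by linarith
    obtain z where z: "norm (f z) = max_mod f r" "\<forall>w\<in>sphere 0 r. norm (f w) \<le> norm (f z)"
      using max_mod_attained[OF cont, of r] r1 by auto
    have M0: "max_mod f r \<ge> 0" using z(1) norm_ge_zero by metis
    have "max_mod f r = (max_mod f r powr \<epsilon>) powr (1/\<epsilon>)"
      using e M0 by (simp add: powr_powr)
    also have "\<dots> \<le> r powr (1/\<epsilon>)"
      using r(2) e unfolding mu_def by (intro powr_mono2) auto
    also have "\<dots> \<le> r powr real k" using r1 k by (intro powr_mono) auto
    also have "\<dots> = r ^ k" using r1 by (simp add: powr_realpow)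
    finally have Mk: "max_mod f r \<le> r ^ k" .
    have "?d \<le> fact n * r ^ k / r ^ n"
    proof (rule Cauchy_inequality)
      show "f holomorphic_on ball 0 r" using hol holomorphic_on_subset by blast
      show "continuous_on (cball 0 r) f" using cont continuous_on_subset by blast
      show "norm (f x) \<le> r ^ k" if "norm (0 - x) = r" for x
        using z Mk that by (force simp: dist_norm)
    qed (use r1 in auto)
    also have "\<dots> \<le> fact n * (1 / r)"
    proof -
      have "r ^ k * r \<le> r ^ n" using power_increasing[of "Suc k" n r] n r1 by (simp add: mult.commute)
      then have "r ^ k / r ^ n \<le> 1 / r" using r1 by (simp add: field_simps)
      then show ?thesis by (simp add: mult_left_mono flip: times_divide_eq_right)
    qed
    finally have "?d * r \<le> fact n" using r1 by (simp add: field_simps)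
    then show False using rd d by (simp add: field_simps)
  qed
  define p where "p = (\<Sum>n\<le>k. monom ((deriv ^^ n) f 0 / fact n) n)"
  have "f z = poly p z" for z
  proof -
    have "f holomorphic_on ball 0 (norm z + 1)" using hol holomorphic_on_subset by blast
    from holomorphic_power_series[OF this, of z]
    have "(\<lambda>n. (deriv ^^ n) f 0 / fact n * z ^ n) sums f z" by simp
    moreover have "(\<lambda>n. (deriv ^^ n) f 0 / fact n * z ^ n) sums
        (\<Sum>n\<le>k. (deriv ^^ n) f 0 / fact n * z ^ n)"
      using deriv0 by (intro sums_finite) auto
    ultimately have "f z = (\<Sum>n\<le>k. (deriv ^^ n) f 0 / fact n * z ^ n)" by (rule sums_unique2)
    then show ?thesis unfolding p_def by (simp add: poly_sum poly_monom)
  qed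
  then show False using f unfolding transcendental_entire_def by blast
qed

lemma admissible_mu_exists:
  assumes "transcendental_entire f"
  shows "\<exists>S. \<forall>\<epsilon>\<in>{0<..<1}. admissible (mu f \<epsilon>) (S \<epsilon>)"
  using admissible_mu_exists_aux[OF assms] by (metis greaterThanLessThan_iff)

lemma admissible_max_mod_exists:
  assumes f: "transcendental_entire f"
  shows "\<exists>R. admissible (max_mod f) R"
proof -
  have cont: "continuous_on UNIV f"
    using f unfolding transcendental_entire_def by (auto intro: holomorphic_on_imp_continuous_on)
  have "mu f 1 r = max_mod f r" if "r > 0" for r
  proof -
    have "max_mod f r \<ge> 0" using max_mod_attained[OF cont that] norm_ge_zero by metis
    then show ?thesis by (simp add: mu_def)
  qed
  then show ?thesis
    using admissible_mu_exists_aux[OF f, of 1] unfolding admissible_def by force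
qed

end

theory Submission
  imports Defs
begin

text \<open>Fix a large \<open>r\<close> and put \<open>\<beta> = M(4r) powr (1 - K / ln (4r))\<close>. Every circle about the origin
  of radius at most \<open>r\<close> carries a point where \<open>|f| \<le> \<beta>\<close>; choose such points on the \<open>n\<close> circles of
  radii \<open>i r / n\<close>, \<open>i < n\<close>, together with a point of modulus \<open>r\<close> where \<open>|f|\<close> equals \<open>M(r)\<close>. The Cauchy
  integral over \<open>|\<zeta>| = 4r\<close> for the divided difference of \<open>f\<close> at these points gives
  \<open>M(r) \<le> 8 ^ n * \<beta> + 4/3 * M(4r) * sqrt (3/16) ^ n\<close>, since distances between the points are at least
  the differences of their moduli. Optimising in \<open>n\<close> yields
  \<open>ln M(r) \<le> ln M(4r) * (1 - c * ln 4 / ln (4r))\<close> with \<open>c = 15/14 > 1\<close>, so \<open>\<phi>(t) = ln M(exp t)\<close> has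
  the property that \<open>\<phi>(t) / t powr c\<close> does not decrease under \<open>t \<mapsto> t + ln 4\<close>. Hence, for each \<open>\<epsilon>\<close>,
  some \<open>l\<close> satisfies \<open>\<epsilon> * \<phi>(l * t) \<ge> l * \<phi>(t)\<close> for all large \<open>t\<close>, and iterating this gives
  \<open>\<epsilon>\<close>-regularity. The equality of the escaping sets follows because the iterates of \<open>M\<close> and of
  \<open>\<mu>\<close> from admissible radii are unbounded.\<close>

section \<open>Lagrange interpolation, partial fractions and divided differences\<close>

text \<open>Both sides are polynomials in \<open>\<zeta>\<close> of degree below
  \<open>card I\<close>, and they agree at the \<open>card I\<close> distinct nodes, so they
  coincide.\<close>

lemma sum_lagrange_basis:
  fixes z :: "'a \<Rightarrow> 'b::field"
  assumes "finite I" "I \<noteq> {}" "inj_on z I"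
  shows "(\<Sum>i\<in>I. \<Prod>j\<in>I - {i}. (\<zeta> - z j) / (z i - z j)) = 1"
proof -
  define l where "l i = (\<Prod>j\<in>I - {i}. smult (1 / (z i - z j)) [:- z j, 1:])" for i
  have poly_l: "poly (l i) x = (\<Prod>j\<in>I - {i}. (x - z j) / (z i - z j))" for i x
    unfolding l_def poly_prod by (intro prod.cong) (auto simp: field_simps diff_divide_distrib)
  have "(\<Sum>i\<in>I. l i) = 1"
  proof (rule poly_eqI_degree[where A = "z ` I"])
    have cpos: "card I > 0" using assms(1,2) by (simp add: card_gt_0_iff)
    have "degree (l i) \<le> card I - 1" if "i \<in> I" for i
    proof -
      have deg1: "degree (smult c [:a, 1:]) \<le> 1" for a c :: 'b
        by (rule order_trans[OF degree_smult_le]) simp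
      have "degree (l i) \<le> (\<Sum>j\<in>I - {i}. degree (smult (1 / (z i - z j)) [:- z j, 1:]))"
        unfolding l_def
        using degree_prod_sum_le[of "I - {i}" "\<lambda>j. smult (1 / (z i - z j)) [:- z j, 1:]"] assms(1)
        by (simp only: o_def finite_Diff)
      also have "\<dots> \<le> (\<Sum>j\<in>I - {i}. 1)" by (intro sum_mono deg1)
      finally show ?thesis using that assms(1) by simp
    qed
    then have "degree (\<Sum>i\<in>I. l i) \<le> card I - 1"
      by (intro degree_sum_le) (use assms(1) in auto)
    then show "degree (\<Sum>i\<in>I. l i) < card (z ` I)" "degree (1::'b poly) < card (z ` I)"
      using cpos assms(3) by (auto simp: card_image)
  next
    fix x assume "x \<in> z ` I"
    then obtain k where k: "k \<in> I" "x = z k" by auto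
    have "poly (l i) x = (if i = k then 1 else 0)" if "i \<in> I" for i
    proof (cases "i = k")
      case True
      have "z k \<noteq> z j" if "j \<in> I - {k}" for j using assms(3) k that by (auto simp: inj_on_def)
      then show ?thesis unfolding poly_l k(2) True by (simp add: prod.neutral)
    next
      case False
      then have "k \<in> I - {i}" using k by blast
      then show ?thesis using False assms(1) unfolding poly_l k(2) by (auto intro!: prod_zero)
    qed
    then have "(\<Sum>i\<in>I. poly (l i) x) = 1" using k(1) assms(1) by simp
    then show "poly (\<Sum>i\<in>I. l i) x = poly 1 x" by (simp add: poly_sum)
  qed
  then have "poly (\<Sum>i\<in>I. l i) \<zeta> = 1" by simp
  then show ?thesis by (simp add: poly_sum poly_l)
qed

text \<open>This is the Lagrange identity divided by the full product: in the term of
  \<open>i\<close> all factors of the numerator cancel except \<open>\<zeta> - z i\<close>.\<close>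

lemma inverse_prod_partial_fractions:
  fixes z :: "'a \<Rightarrow> 'b::field"
  assumes "finite I" "I \<noteq> {}" "inj_on z I" "\<zeta> \<notin> z ` I"
  shows "1 / (\<Prod>i\<in>I. \<zeta> - z i) = (\<Sum>i\<in>I. 1 / (\<zeta> - z i) / (\<Prod>j\<in>I - {i}. z i - z j))"
proof -
  have nz: "(\<Prod>i\<in>I. \<zeta> - z i) \<noteq> 0" using assms by (auto simp: prod_zero_iff)
  have "1 / (\<Prod>i\<in>I. \<zeta> - z i) =
      (\<Sum>i\<in>I. (\<Prod>j\<in>I - {i}. (\<zeta> - z j) / (z i - z j))) / (\<Prod>i\<in>I. \<zeta> - z i)"
    using sum_lagrange_basis[OF assms(1-3)] by simp
  also have "\<dots> = (\<Sum>i\<in>I. (\<Prod>j\<in>I - {i}. (\<zeta> - z j) / (z i - z j)) / (\<Prod>i\<in>I. \<zeta> - z i))"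
    by (rule sum_divide_distrib)
  also have "\<dots> = (\<Sum>i\<in>I. 1 / (\<zeta> - z i) / (\<Prod>j\<in>I - {i}. z i - z j))"
  proof (intro sum.cong refl)
    fix i assume i: "i \<in> I"
    have "(\<Prod>i\<in>I. \<zeta> - z i) = (\<zeta> - z i) * (\<Prod>j\<in>I - {i}. \<zeta> - z j)"
      using assms(1) i by (rule prod.remove)
    then show "(\<Prod>j\<in>I - {i}. (\<zeta> - z j) / (z i - z j)) / (\<Prod>i\<in>I. \<zeta> - z i) =
        1 / (\<zeta> - z i) / (\<Prod>j\<in>I - {i}. z i - z j)"
      using nz by (simp add: prod_dividef)
  qed
  finally show ?thesis .
qed

text \<open>The sum is the divided difference of \<open>f\<close> at the nodes. Cauchy's formula for
  each term, together with partial fractions, represents it as the integral of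
  \<open>f u / (\<Prod>i\<in>I. u - z i)\<close> over the circle, up to the factor
  \<open>2 * pi * \<i>\<close>. There each factor of the product has modulus at least
  \<open>R - norm (z i)\<close>.\<close>

lemma norm_divided_difference_le:
  fixes z :: "'a \<Rightarrow> complex"
  assumes "finite I" "I \<noteq> {}" "inj_on z I"
    and zR: "\<And>i. i \<in> I \<Longrightarrow> norm (z i) < R"
    and hol: "f holomorphic_on cball 0 R"
    and B: "\<And>\<zeta>. norm \<zeta> = R \<Longrightarrow> norm (f \<zeta>) \<le> B"
  shows "norm (\<Sum>i\<in>I. f (z i) / (\<Prod>j\<in>I - {i}. z i - z j)) \<le> R * B / (\<Prod>i\<in>I. R - norm (z i))"
proof -
  let ?d = "\<lambda>i. \<Prod>j\<in>I - {i}. z i - z j"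
  let ?S = "\<Sum>i\<in>I. f (z i) / ?d i"
  obtain i0 where "i0 \<in> I" using assms(2) by blast
  then have R: "R > 0" using zR norm_ge_zero le_less_trans by blast
  have Ppos: "(\<Prod>i\<in>I. R - norm (z i)) > 0" using zR by (intro prod_pos) auto
  have B0: "0 \<le> B" using B[of "of_real R"] R by (intro order_trans[OF norm_ge_zero]) auto
  have "((\<lambda>u. \<Sum>i\<in>I. f u / (u - z i) / ?d i) has_contour_integral
      (\<Sum>i\<in>I. 2 * of_real pi * \<i> * f (z i) / ?d i)) (circlepath 0 R)"
    using zR by (intro has_contour_integral_sum assms(1) has_contour_integral_div
        Cauchy_integral_circlepath_simple hol) auto
  also have "(\<Sum>i\<in>I. 2 * of_real pi * \<i> * f (z i) / ?d i) = 2 * of_real pi * \<i> * ?S"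
    by (simp add: sum_distrib_left)
  finally have int: "((\<lambda>u. \<Sum>i\<in>I. f u / (u - z i) / ?d i) has_contour_integral
      2 * of_real pi * \<i> * ?S) (circlepath 0 R)" .
  have "norm (2 * of_real pi * \<i> * ?S) \<le> B / (\<Prod>i\<in>I. R - norm (z i)) * (2 * pi * R)"
  proof (rule has_contour_integral_bound_circlepath[OF int _ R])
    fix u :: complex assume "norm (u - 0) = R"
    then have u: "norm u = R" by simp
    have un: "u \<notin> z ` I" using u zR by force
    have "(\<Sum>i\<in>I. f u / (u - z i) / ?d i) = f u * (\<Sum>i\<in>I. 1 / (u - z i) / ?d i)"
      by (simp add: sum_distrib_left)
    also have "\<dots> = f u / (\<Prod>i\<in>I. u - z i)"
      unfolding inverse_prod_partial_fractions[OF assms(1-3) un, symmetric] by simp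
    finally have "norm (\<Sum>i\<in>I. f u / (u - z i) / ?d i) = norm (f u) / (\<Prod>i\<in>I. norm (u - z i))"
      by (simp add: norm_divide prod_norm)
    also have "\<dots> \<le> B / (\<Prod>i\<in>I. R - norm (z i))"
    proof (rule frac_le)
      show "(\<Prod>i\<in>I. R - norm (z i)) \<le> (\<Prod>i\<in>I. norm (u - z i))"
      proof (rule prod_mono)
        show "0 \<le> R - norm (z i) \<and> R - norm (z i) \<le> norm (u - z i)" if "i \<in> I" for i
          using zR[OF that] norm_triangle_ineq2[of u "z i"] u by auto
      qed
    qed (use B u B0 Ppos in auto)
    finally show "norm (\<Sum>i\<in>I. f u / (u - z i) / ?d i) \<le> B / (\<Prod>i\<in>I. R - norm (z i))" .
  qed (use B0 Ppos in auto)
  then have "(2 * pi) * norm ?S \<le> (2 * pi) * (R * B / (\<Prod>i\<in>I. R - norm (z i)))"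
    by (simp add: norm_mult mult_ac)
  then show ?thesis by (simp only: mult_le_cancel_left_pos pi_gt_zero mult_pos_pos zero_less_numeral)
qed

section \<open>Products and sums for equally spaced moduli\<close>

lemma prod_abs_diff_nat:
  assumes "i \<le> n"
  shows "(\<Prod>j\<in>{..n} - {i}. \<bar>real i - real j\<bar>) = fact i * fact (n - i)"
proof -
  have split: "{..n} - {i} = {..<i} \<union> {i<..n}" using assms by auto
  have "(\<Prod>j<i. \<bar>real i - real j\<bar>) = (\<Prod>k\<in>{1..i}. real k)"
    by (rule prod.reindex_bij_witness[where i = "\<lambda>k. i - k" and j = "\<lambda>j. i - j"]) (auto simp: of_nat_diff)
  moreover have "(\<Prod>j\<in>{i<..n}. \<bar>real i - real j\<bar>) = (\<Prod>k\<in>{1..n - i}. real k)"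
    by (rule prod.reindex_bij_witness[where i = "\<lambda>k. i + k" and j = "\<lambda>j. j - i"]) (auto simp: of_nat_diff)
  ultimately show ?thesis
    unfolding split by (subst prod.union_disjoint) (auto simp: fact_prod)
qed

text \<open>For \<open>n = m + 1\<close> the product is \<open>(2m+1)! / m!\<close>, that is,
  \<open>n!\<close> times the binomial coefficient of \<open>2m+1\<close> over \<open>n\<close>,
  which is at most \<open>2 ^ (2 * n)\<close>.\<close>

lemma prod_upper_half_le:
  assumes "n \<ge> 1"
  shows "(\<Prod>i<n. real n + real i) \<le> 4 ^ n * fact n"
proof -
  obtain m where n: "n = Suc m" using assms by (cases n) auto
  have prod_fact: "(\<Prod>i<k. real (Suc m) + real i) * fact m = fact (m + k)" for k
  proof (induction k)
    case (Suc k)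
    have "(\<Prod>i<Suc k. real (Suc m) + real i) * fact m =
        (real (Suc m) + real k) * ((\<Prod>i<k. real (Suc m) + real i) * fact m)"
      by (simp add: mult_ac)
    then show ?case unfolding Suc by (simp add: algebra_simps)
  qed simp
  have "fact n * fact m * (2 * m + 1 choose n) = fact (2 * m + 1)"
    using binomial_fact_lemma[of n "2 * m + 1"] by (simp add: n)
  then have "fact n * fact m * real (2 * m + 1 choose n) = fact (2 * m + 1)"
    by (metis of_nat_fact of_nat_mult)
  then have "(\<Prod>i<n. real n + real i) * fact m = (fact n * real (2 * m + 1 choose n)) * fact m"
  proof -
    have "m + n = 2 * m + 1" by (simp add: n)
    then have "(\<Prod>i<n. real n + real i) * fact m = fact (2 * m + 1)"
      using prod_fact[of n] unfolding n by presburger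
    then show ?thesis using \<open>fact n * fact m * real _ = _\<close> by (simp only: mult_ac)
  qed
  then have "(\<Prod>i<n. real n + real i) = fact n * real (2 * m + 1 choose n)" by simp
  also have "\<dots> \<le> fact n * 2 ^ (2 * n)"
  proof (rule mult_left_mono)
    have "(2 * m + 1 choose n) \<le> 2 ^ (2 * n)"
      by (rule order_trans[OF binomial_le_pow2]) (simp add: n)
    then show "real (2 * m + 1 choose n) \<le> 2 ^ (2 * n)"
      by (metis of_nat_le_iff of_nat_power of_nat_numeral)
  qed simp
  also have "(2::real) ^ (2 * n) = 4 ^ n" by (simp add: power_mult)
  finally show ?thesis by (simp only: mult.commute)
qed

lemma sum_inverse_fact_mult: "(\<Sum>i\<le>n. 1 / (fact i * fact (n - i))) = (2::real) ^ n / fact n"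
proof -
  have "(\<Sum>i\<le>n. 1 / (fact i * fact (n - i))) = (\<Sum>i\<le>n. real (n choose i) / fact n)"
    by (intro sum.cong) (auto simp: binomial_fact)
  also have "\<dots> = real (\<Sum>i\<le>n. n choose i) / fact n" by (simp add: sum_divide_distrib)
  finally show ?thesis by (simp add: choose_row_sum)
qed

text \<open>Pairing the factors \<open>i\<close> and \<open>n - 1 - i\<close>, each product of two is at most \<open>3/16\<close>.\<close>

lemma prod_ratio_le: "(\<Prod>i<n. (real n + real i) / (4 * real n - real i)) \<le> sqrt (3 / 16) ^ n"
proof -
  let ?g = "\<lambda>i. (real n + real i) / (4 * real n - real i)"
  let ?P = "\<Prod>i<n. ?g i"
  have rev: "?P = (\<Prod>i<n. ?g (n - Suc i))" by (rule prod.nat_diff_reindex[symmetric])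
  have "?P ^ 2 = (\<Prod>i<n. ?g i * ?g (n - Suc i))"
    unfolding power2_eq_square by (subst (2) rev) (simp only: prod.distrib)
  also have "\<dots> \<le> (\<Prod>i<n. 3 / 16)"
  proof (rule prod_mono)
    fix i assume "i \<in> {..<n}"
    then have i: "real i + 1 \<le> real n" by auto
    have e: "real (n - Suc i) = real n - 1 - real i" using i by (simp add: of_nat_diff)
    define N x where "N = real n" and "x = real i"
    have x: "0 \<le> x" "x + 1 \<le> N" using i by (auto simp: N_def x_def)
    have d: "0 < 4 * N - x" "0 < 3 * N + 1 + x" using x by auto
    \<comment> \<open>The numerator factors have sum \<open>3 * N - 1\<close> and differ by
      \<open>2 * x + 1 - N\<close> up to sign, so their product is at most a quarter of
      \<open>(3 * N - 1) ^ 2\<close>. The denominator is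
      \<open>12 * N ^ 2 + 4 * N + x * (N - 1 - x)\<close>. The quotient of 9/4 and 12 is
      3/16.\<close>
    have sq: "0 \<le> (2 * x + 1 - N)\<^sup>2" by simp
    have up: "(N + x) * (2 * N - 1 - x) \<le> 9 / 4 * N\<^sup>2"
      using sq x by (simp add: power2_eq_square algebra_simps)
    have "x * (N - 1 - x) \<ge> 0" using x by (intro mult_nonneg_nonneg) auto
    then have low: "12 * N\<^sup>2 \<le> (4 * N - x) * (3 * N + 1 + x)"
      using x by (simp add: power2_eq_square algebra_simps)
    have g: "?g i * ?g (n - Suc i) = ((N + x) * (2 * N - 1 - x)) / ((4 * N - x) * (3 * N + 1 + x))"
      unfolding e by (simp add: N_def x_def algebra_simps)
    have "16 * ((N + x) * (2 * N - 1 - x)) \<le> 3 * ((4 * N - x) * (3 * N + 1 + x))"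
      using up low by linarith
    then have "?g i * ?g (n - Suc i) \<le> 3 / 16"
      unfolding g using d by (simp add: divide_le_eq mult_pos_pos)
    moreover have "0 \<le> ?g i * ?g (n - Suc i)"
      unfolding g using d x by (intro divide_nonneg_nonneg mult_nonneg_nonneg) auto
    ultimately show "0 \<le> ?g i * ?g (n - Suc i) \<and> ?g i * ?g (n - Suc i) \<le> 3 / 16" by blast
  qed
  also have "\<dots> = (sqrt (3 / 16) ^ n) ^ 2"
  proof -
    have "(sqrt (3 / 16) ^ n)\<^sup>2 = ((sqrt (3 / 16))\<^sup>2) ^ n" by (simp only: mult.commute flip: power_mult)
    then show ?thesis by (simp only: prod_constant card_lessThan real_sqrt_pow2)
  qed
  finally show ?thesis by (rule power2_le_imp_le) simp
qed

section \<open>Bounding a value by small values on inner circles\<close>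

text \<open>The divided difference \<open>S\<close> at \<open>n + 1\<close> nodes, the last of which
  is \<open>z\<close>, is solved for the term containing \<open>f z\<close>. The Cauchy estimate for
  \<open>S\<close> yields the summand with \<open>A\<close>; the other terms contain only values of
  modulus at most \<open>\<beta>\<close>.\<close>

lemma norm_le_if_small_on_circles:
  assumes hol: "f holomorphic_on cball 0 (4 * R)" and R: "R > 0" and n: "n \<ge> 1"
    and small: "\<And>s. 0 \<le> s \<Longrightarrow> s \<le> R \<Longrightarrow> \<exists>w. norm w = s \<and> norm (f w) \<le> \<beta>"
    and A: "\<And>\<zeta>. norm \<zeta> = 4 * R \<Longrightarrow> norm (f \<zeta>) \<le> A"
    and z: "norm z = R"
  shows "norm (f z) \<le> 8 ^ n * \<beta> + 4 / 3 * A * sqrt (3 / 16) ^ n"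
proof -
  \<comment> \<open>Equal spacing of the moduli turns the products of gaps into factorials. Node 0
    is the origin and node \<open>n\<close> is \<open>z\<close> itself.\<close>
  have "\<exists>w. norm w = R * real i / real n \<and> (i < n \<longrightarrow> norm (f w) \<le> \<beta>) \<and> (i = n \<longrightarrow> w = z)"
    if "i \<le> n" for i
  proof (cases "i = n")
    case True
    then show ?thesis using z n by auto
  next
    case False
    have "R * real i / real n \<le> R" using R n that by (simp add: divide_le_eq)
    then show ?thesis using small[of "R * real i / real n"] R False by auto
  qed
  then obtain w where w0: "\<forall>i\<in>{..n}. norm (w i) = R * real i / real n \<and>
      (i < n \<longrightarrow> norm (f (w i)) \<le> \<beta>) \<and> (i = n \<longrightarrow> w i = z)"
    using bchoice[of "{..n}" "\<lambda>i w. norm w = R * real i / real n \<and>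
      (i < n \<longrightarrow> norm (f w) \<le> \<beta>) \<and> (i = n \<longrightarrow> w = z)"] by blast
  then have w: "\<And>i. i \<le> n \<Longrightarrow> norm (w i) = R * real i / real n"
      "\<And>i. i < n \<Longrightarrow> norm (f (w i)) \<le> \<beta>" "w n = z"
    by auto
  have \<beta>0: "0 \<le> \<beta>" using w(2)[of 0] n by (intro order_trans[OF norm_ge_zero]) auto
  have A0: "0 \<le> A" using A[of "of_real (4 * R)"] R by (intro order_trans[OF norm_ge_zero]) auto
  have np: "real n > 0" using n by simp
  have dist: "R / real n * \<bar>real i - real j\<bar> \<le> norm (w i - w j)" if "i \<le> n" "j \<le> n" for i j
  proof -
    have "norm (w i) - norm (w j) = R / real n * (real i - real j)"
      using np by (simp add: w(1) that field_simps)
    then have "R / real n * \<bar>real i - real j\<bar> = \<bar>norm (w i) - norm (w j)\<bar>"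
      using R np by (simp add: abs_mult)
    then show ?thesis using norm_triangle_ineq3[of "w i" "w j"] by simp
  qed
  have inj: "inj_on w {..n}"
  proof (rule inj_onI)
    fix i j assume "i \<in> {..n}" "j \<in> {..n}" and eq: "w i = w j"
    then have "R / real n * \<bar>real i - real j\<bar> \<le> 0" using dist[of i j] by simp
    moreover have "R / real n > 0" using R np by simp
    ultimately have "\<not> 0 < \<bar>real i - real j\<bar>"
      using mult_pos_pos[of "R / real n" "\<bar>real i - real j\<bar>"] by linarith
    then show "i = j" by simp
  qed
  define d where "d i = (\<Prod>j\<in>{..n} - {i}. w i - w j)" for i
  define q where "q = (R / real n) ^ n"
  have qpos: "q > 0" unfolding q_def using R np by simp
  have d_lower: "q * (fact i * fact (n - i)) \<le> norm (d i)" if i: "i \<le> n" for i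
  proof -
    have "card ({..n} - {i}) = n" using i by simp
    then have "q * (fact i * fact (n - i)) = (\<Prod>j\<in>{..n} - {i}. R / real n * \<bar>real i - real j\<bar>)"
      unfolding q_def prod_abs_diff_nat[OF i, symmetric] by (simp only: prod.distrib prod_constant)
    also have "\<dots> \<le> (\<Prod>j\<in>{..n} - {i}. norm (w i - w j))"
      using dist i R np by (intro prod_mono) auto
    finally show ?thesis by (simp add: d_def prod_norm)
  qed
  have d_nonzero: "d i \<noteq> 0" if "i \<le> n" for i
    using that inj by (auto simp: d_def inj_on_def)
  have dn_eq: "d n = (\<Prod>j<n. w n - w j)"
    unfolding d_def by (intro prod.cong) auto
  have dn_upper: "norm (d n) \<le> q * (\<Prod>j<n. real n + real j)"
  proof -
    have "norm (d n) = (\<Prod>j<n. norm (w n - w j))" by (simp add: dn_eq prod_norm)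
    also have "\<dots> \<le> (\<Prod>j<n. R / real n * (real n + real j))"
    proof (rule prod_mono)
      fix j assume "j \<in> {..<n}"
      then have "norm (w n) + norm (w j) = R / real n * (real n + real j)"
        using np by (simp add: w(1) field_simps)
      then show "0 \<le> norm (w n - w j) \<and> norm (w n - w j) \<le> R / real n * (real n + real j)"
        using norm_triangle_ineq4[of "w n" "w j"] by simp
    qed
    also have "\<dots> = q * (\<Prod>j<n. real n + real j)" by (simp only: q_def prod.distrib prod_constant card_lessThan)
    finally show ?thesis .
  qed
  define S where "S = (\<Sum>i\<le>n. f (w i) / d i)"
  have S_le: "norm S \<le> 4 * R * A / (\<Prod>i\<le>n. 4 * R - norm (w i))"
    unfolding S_def d_def
  proof (rule norm_divided_difference_le[OF _ _ inj _ hol])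
    fix i assume "i \<in> {..n}"
    then have "R * real i / real n \<le> R" using R np by (simp add: divide_le_eq)
    then show "norm (w i) < 4 * R" using w(1)[of i] \<open>i \<in> {..n}\<close> R by simp
  qed (use A in auto)
  \<comment> \<open>The node \<open>z\<close> contributes \<open>3 * R\<close>; set against the
    \<open>4 * R\<close> in the bound for \<open>S\<close>, it produces the constant 4/3. The scale
    \<open>q\<close> cancels against that of \<open>d n\<close>.\<close>
  have prod_circle: "(\<Prod>i\<le>n. 4 * R - norm (w i)) = 3 * R * (q * (\<Prod>i<n. 4 * real n - real i))"
  proof -
    have "(\<Prod>i\<le>n. 4 * R - norm (w i)) = (4 * R - norm (w n)) * (\<Prod>i<n. 4 * R - norm (w i))"
      by (simp add: lessThan_Suc_atMost[symmetric] mult.commute)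
    also have "(\<Prod>i<n. 4 * R - norm (w i)) = (\<Prod>i<n. R / real n * (4 * real n - real i))"
      using np by (intro prod.cong) (auto simp: w(1) field_simps)
    also have "\<dots> = q * (\<Prod>i<n. 4 * real n - real i)"
      by (simp only: q_def prod.distrib prod_constant card_lessThan)
    finally show ?thesis using np by (simp add: w(1))
  qed
  have fz: "f z = d n * S - d n * (\<Sum>i<n. f (w i) / d i)"
  proof -
    have "S = f z / d n + (\<Sum>i<n. f (w i) / d i)"
      by (simp add: S_def lessThan_Suc_atMost[symmetric] w(3) add.commute)
    then show ?thesis using d_nonzero[of n] by (simp add: field_simps)
  qed
  have first: "norm (d n * S) \<le> 4 / 3 * A * sqrt (3 / 16) ^ n"
  proof -
    have pos: "(\<Prod>i<n. 4 * real n - real i) > 0" by (intro prod_pos) auto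
    have "norm (d n * S) \<le> (q * (\<Prod>j<n. real n + real j)) *
        (4 * R * A / (\<Prod>i\<le>n. 4 * R - norm (w i)))"
      unfolding norm_mult by (intro mult_mono dn_upper S_le mult_nonneg_nonneg prod_nonneg) (use qpos in auto)
    also have "\<dots> = 4 / 3 * A * (\<Prod>i<n. (real n + real i) / (4 * real n - real i))"
      unfolding prod_circle prod_dividef using R qpos pos by (simp add: field_simps)
    also have "\<dots> \<le> 4 / 3 * A * sqrt (3 / 16) ^ n"
      using A0 by (intro mult_left_mono prod_ratio_le) auto
    finally show ?thesis .
  qed
  have second: "norm (d n * (\<Sum>i<n. f (w i) / d i)) \<le> 8 ^ n * \<beta>"
  proof -
    have "norm (\<Sum>i<n. f (w i) / d i) \<le> (\<Sum>i<n. \<beta> / (q * (fact i * fact (n - i))))"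
    proof (rule sum_norm_le)
      fix i assume "i \<in> {..<n}"
      then show "norm (f (w i) / d i) \<le> \<beta> / (q * (fact i * fact (n - i)))"
        unfolding norm_divide using w(2)[of i] d_lower[of i] qpos \<beta>0 by (intro frac_le) auto
    qed
    also have "\<dots> \<le> (\<Sum>i\<le>n. \<beta> / (q * (fact i * fact (n - i))))"
      using \<beta>0 qpos by (intro sum_mono2) auto
    also have "\<dots> = \<beta> / q * (\<Sum>i\<le>n. 1 / (fact i * fact (n - i)))"
      by (simp add: sum_distrib_left)
    finally have s: "norm (\<Sum>i<n. f (w i) / d i) \<le> \<beta> / q * (2 ^ n / fact n)"
      unfolding sum_inverse_fact_mult .
    \<comment> \<open>The base 8 is 4 from the product \<open>d n\<close> times 2 from the row sum
      of binomial coefficients.\<close>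
    have "norm (d n * (\<Sum>i<n. f (w i) / d i)) \<le> (q * (\<Prod>j<n. real n + real j)) * (\<beta> / q * (2 ^ n / fact n))"
      unfolding norm_mult by (intro mult_mono dn_upper s mult_nonneg_nonneg prod_nonneg) (use qpos in auto)
    also have "\<dots> \<le> (q * (4 ^ n * fact n)) * (\<beta> / q * (2 ^ n / fact n))"
      using \<beta>0 qpos by (intro mult_right_mono mult_left_mono prod_upper_half_le n) auto
    also have "\<dots> = (4 * 2) ^ n * \<beta>" unfolding power_mult_distrib using qpos by simp
    finally show ?thesis by simp
  qed
  show ?thesis unfolding fz using first second norm_triangle_ineq4 by (smt (verit))
qed

section \<open>Monotonicity and growth of the maximum modulus\<close>

text \<open>This is the maximum modulus principle on the closed disc. Radius 0 is included so that
  monotonicity and nonnegativity hold from 0 on.\<close>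

lemma max_mod_bound:
  assumes "f holomorphic_on UNIV" "norm z \<le> r"
  shows "norm (f z) \<le> max_mod f r"
proof (cases "r = 0")
  case True
  then show ?thesis using assms(2) by (simp add: max_mod_def)
next
  case False
  then have r: "r > 0" using assms(2) norm_ge_zero[of z] by linarith
  show ?thesis
  proof (rule maximum_modulus_frontier[where S = "cball 0 r" and f = f])
    have cont: "continuous_on UNIV f" using assms(1) by (rule holomorphic_on_imp_continuous_on)
    show "continuous_on (closure (cball 0 r)) f" using cont continuous_on_subset by blast
    show "f holomorphic_on interior (cball 0 r)" using assms(1) holomorphic_on_subset by blast
    show "norm (f w) \<le> max_mod f r" if "w \<in> frontier (cball 0 r)" for w
      using max_mod_attained[OF cont r] that r by (auto simp: frontier_cball)
  qed (use assms in auto)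
qed

lemma max_mod_nonneg: "f holomorphic_on UNIV \<Longrightarrow> r \<ge> 0 \<Longrightarrow> 0 \<le> max_mod f r"
  using max_mod_bound[of f 0 r] by (intro order_trans[OF norm_ge_zero]) auto

lemma max_mod_mono:
  assumes "f holomorphic_on UNIV" "0 \<le> r" "r \<le> s"
  shows "max_mod f r \<le> max_mod f s"
  unfolding max_mod_def[of f r]
  using assms by (intro cSUP_least max_mod_bound) auto

text \<open>An admissible radius for \<open>mu f (1 / N)\<close> is one beyond which
  \<open>max_mod f r powr (1 / N) > r\<close>; raising this to the power \<open>N\<close> gives the
  growth.\<close>

lemma eventually_max_mod_ge_powr:
  assumes f: "transcendental_entire f" and N: "N > 0"
  shows "eventually (\<lambda>r. max_mod f r \<ge> r powr N) at_top"
proof -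
  have hol: "f holomorphic_on UNIV" using f by (simp add: transcendental_entire_def)
  obtain R where R: "admissible (mu f (1 / N)) R"
    using admissible_mu_exists_aux[OF f, of "1 / N"] N by auto
  show ?thesis
  proof (rule eventually_at_top_linorderI[of R])
    fix r assume "r \<ge> R"
    then have r: "r > 0" "max_mod f r powr (1 / N) > r"
      using R by (auto simp: admissible_def mu_def)
    then have "r powr N \<le> (max_mod f r powr (1 / N)) powr N" using N by (intro powr_mono2) auto
    also have "\<dots> = max_mod f r" using N max_mod_nonneg[OF hol, of r] r(1) by (simp add: powr_powr)
    finally show "max_mod f r \<ge> r powr N" .
  qed
qed

section \<open>Choosing the number of nodes; the growth step from \<open>r\<close> to
  \<open>4 * r\<close>\<close>

text \<open>Since \<open>sqrt (3 / 16)\<close> is at most \<open>8 powr (-2/5)\<close>, equating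
  \<open>8 ^ n = exp (\<theta> * x)\<close> with \<open>exp (x - 2/5 * \<theta> * x)\<close> gives
  \<open>\<theta> = 5/7\<close>. Rounding \<open>n\<close> down costs at most
  \<open>8 powr (2/5)\<close>, hence at most a factor 3, in the second term: the total constant is 1
  + 4/3 * 3 = 5.\<close>

lemma two_bounds_balance:
  fixes b x :: real
  assumes x: "x \<ge> 7 / 5 * ln 8"
  obtains n :: nat where "n \<ge> 1"
    "8 ^ n * exp b + 4 / 3 * exp (b + x) * sqrt (3 / 16) ^ n \<le> 5 * exp (b + 5 / 7 * x)"
proof -
  define y where "y = 5 * x / (7 * ln 8)"
  have l8: "ln (8::real) > 0" by simp
  have y1: "y \<ge> 1" using x l8 by (simp add: y_def le_divide_eq)
  define n where "n = nat \<lfloor>y\<rfloor>"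
  have n: "n \<ge> 1" "real n \<le> y" "y < real n + 1" using y1 unfolding n_def by linarith+
  have yl: "y * ln 8 = 5 / 7 * x" using l8 by (simp add: y_def)
  have n_upper: "real n * ln 8 \<le> 5 / 7 * x"
    unfolding yl[symmetric] using n(2) l8 by (intro mult_right_mono) auto
  have n_lower: "5 / 7 * x \<le> real n * ln 8 + ln 8"
  proof -
    have "y * ln 8 \<le> (real n + 1) * ln 8" using n(3) l8 by (intro mult_right_mono) auto
    then show ?thesis unfolding yl by (simp add: algebra_simps)
  qed
  \<comment> \<open>In integers this is \<open>3 ^ 5 * 8 ^ 4 <= 16 ^ 5\<close>.\<close>
  have ln_sqrt_le: "ln (sqrt (3 / 16)) \<le> - (2 / 5) * ln (8::real)"
  proof -
    have "ln ((3 / 16) ^ 5 :: real) \<le> ln ((1 / 8) ^ 4)"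
      by (subst ln_le_cancel_iff) (simp_all add: power_divide)
    then have "5 * ln (3 / 16 :: real) \<le> 4 * ln (1 / 8)" unfolding ln_realpow by simp
    moreover have "ln (1 / 8 :: real) = - ln 8" by (simp add: ln_div)
    moreover have "ln (sqrt (3 / 16)) = ln (3 / 16 :: real) / 2" by (rule ln_sqrt) simp
    ultimately show ?thesis by linarith
  qed
  have ln83: "2 / 5 * ln (8::real) \<le> ln 3"
  proof -
    have "ln (8 ^ 2 :: real) \<le> ln (3 ^ 5)" by (subst ln_le_cancel_iff) simp_all
    then have "2 * ln (8::real) \<le> 5 * ln 3" unfolding ln_realpow by simp
    then show ?thesis by linarith
  qed
  have "8 ^ n * exp b = exp (real n * ln 8) * exp b" by (simp add: exp_of_nat_mult)
  also have "\<dots> \<le> exp (b + 5 / 7 * x)" using n_upper by (simp flip: exp_add)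
  finally have first: "8 ^ n * exp b \<le> exp (b + 5 / 7 * x)" .
  have "sqrt (3 / 16) ^ n = exp (real n * ln (sqrt (3 / 16)))" by (simp add: exp_of_nat_mult)
  also have "\<dots> \<le> exp (ln 3 - 2 / 7 * x)"
  proof -
    have "real n * ln (sqrt (3 / 16)) \<le> real n * (- (2 / 5) * ln 8)"
      by (rule mult_left_mono[OF ln_sqrt_le]) simp
    then show ?thesis using n_lower ln83 by simp
  qed
  finally have q: "sqrt (3 / 16) ^ n \<le> exp (ln 3 - 2 / 7 * x)" .
  have "4 / 3 * exp (b + x) * sqrt (3 / 16) ^ n \<le> 4 / 3 * exp (b + x) * exp (ln 3 - 2 / 7 * x)"
    by (intro mult_left_mono q) simp
  also have "\<dots> = 4 * exp (b + 5 / 7 * x)"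
  proof -
    have "exp (b + x) * exp (ln 3 - 2 / 7 * x) = exp (ln 3 + (b + 5 / 7 * x))"
      unfolding exp_add[symmetric] by (rule arg_cong[of _ _ exp]) simp
    also have "\<dots> = 3 * exp (b + 5 / 7 * x)" by (simp add: exp_add)
    finally show ?thesis by simp
  qed
  finally show thesis using that[OF n(1)] first by force
qed

text \<open>The bound from small values on circles is applied with \<open>\<beta> = exp b\<close>,
  where \<open>exp b\<close> is \<open>max_mod f (4 * r) powr (1 - K / T)\<close>. Balancing the two
  terms saves \<open>2/7 * x\<close> with \<open>x = K * L / T\<close>. The value of
  \<open>K\<close> makes this saving, less \<open>ln 5\<close>, exceed \<open>ln 4 * L / T\<close>
  by the factor 15/14, and a factor above 1 is what the later growth argument needs.\<close>

lemma ln_max_mod_step: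
  assumes f: "transcendental_entire f" and K: "K = 4 * ln 4" and r0: "r0 > 1"
    and small: "\<forall>r\<ge>r0. min_mod f r \<le> max_mod f r powr (1 - K / ln r)"
  shows "eventually (\<lambda>r. ln (max_mod f r) \<le>
           ln (max_mod f (4 * r)) * (1 - 15 / 14 * ln 4 / ln (4 * r))) at_top"
proof -
  have hol: "f holomorphic_on UNIV" using f by (simp add: transcendental_entire_def)
  then have cont: "continuous_on UNIV f" by (rule holomorphic_on_imp_continuous_on)
  have Kpos: "K > 0" unfolding K by simp
  \<comment> \<open>The exponent 20 gives \<open>L >= 20 * T\<close>, hence
    \<open>x >= 20 * K\<close>, which suffices for \<open>ln 5 <= x / 56\<close> at the end.\<close>
  obtain r' where r': "\<And>r. r \<ge> r' \<Longrightarrow> max_mod f r \<ge> r powr 20"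
    using eventually_max_mod_ge_powr[OF f, of 20] by (auto simp: eventually_at_top_linorder)
  define r1 where "r1 = Max {r0, r', exp K}"
  have r1: "r1 \<ge> r0" "r1 \<ge> r'" "r1 \<ge> exp K" unfolding r1_def by auto
  \<comment> \<open>The second entry forces \<open>K / T <= 1/2\<close> and so
    \<open>b >= L / 2\<close>; with this, the third gives
    \<open>max_mod f r1 <= exp b\<close>.\<close>
  define r2 where "r2 = Max {r1, exp (2 * K), (max_mod f r1)\<^sup>2}"
  have "ln (max_mod f r) \<le> ln (max_mod f (4 * r)) * (1 - 15 / 14 * ln 4 / ln (4 * r))"
    if "r \<ge> r2" for r
  proof -
    have r: "r \<ge> r1" "r \<ge> exp (2 * K)" "r \<ge> (max_mod f r1)\<^sup>2" using that unfolding r2_def by auto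
    have rpos: "r > 1" using r(1) r1(1) r0 by linarith
    define T where "T = ln (4 * r)"
    define L where "L = ln (max_mod f (4 * r))"
    have M1: "max_mod f s \<ge> 1" if "s \<ge> r1" for s
    proof -
      have "1 \<le> s powr 20" using that r1(1) r0 by (intro ge_one_powr_ge_zero) auto
      then show ?thesis using r'[of s] that r1(2) by linarith
    qed
    have M4: "max_mod f (4 * r) \<ge> 1" using M1[of "4 * r"] r(1) rpos by simp
    then have expL: "exp L = max_mod f (4 * r)" by (simp add: L_def)
    have T2K: "T \<ge> 2 * K"
    proof -
      have "2 * K = ln (exp (2 * K))" by simp
      also have "\<dots> \<le> T" unfolding T_def by (subst ln_le_cancel_iff) (use r(2) rpos in auto)
      finally show ?thesis .
    qed
    then have Tpos: "T > 0" using Kpos by linarith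
    have LT: "L \<ge> 20 * T"
    proof -
      have "ln ((4 * r) powr 20) \<le> L"
        unfolding L_def using r'[of "4 * r"] r(1) r1(2) rpos M4 by (subst ln_le_cancel_iff) auto
      moreover have "ln ((4 * r) powr 20) = 20 * T" unfolding T_def by (rule ln_powr)
      ultimately show ?thesis by linarith
    qed
    have Lpos: "L > 0" using LT Tpos by linarith
    define x where "x = K * L / T"
    define b where "b = L - x"
    have b_eq: "b = L * (1 - K / T)" by (simp add: b_def x_def algebra_simps)
    have x20: "x \<ge> 20 * K"
    proof -
      have "K * (20 * T) \<le> K * L" using LT Kpos by (intro mult_left_mono) auto
      then show ?thesis using Tpos unfolding x_def by (simp add: le_divide_eq mult_ac)
    qed
    have ln8: "ln (8::real) = 3 * ln 2" using ln_realpow[of "2::real" 3] by simp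
    have ln4: "ln (4::real) = 2 * ln 2" using ln_realpow[of "2::real" 2] by simp
    have "x \<ge> 7 / 5 * ln 8" using x20 ln_gt_zero[of "2::real"] unfolding K ln8 ln4 by linarith
    then obtain n where n: "n \<ge> 1"
      "8 ^ n * exp b + 4 / 3 * exp (b + x) * sqrt (3 / 16) ^ n \<le> 5 * exp (b + 5 / 7 * x)"
      by (rule two_bounds_balance)
    have expb: "exp b = max_mod f (4 * r) powr (1 - K / T)"
      unfolding b_eq L_def powr_def using M4 by simp
    have b_half: "b \<ge> L / 2"
    proof -
      have "K / T \<le> 1 / 2" using T2K Tpos by (simp add: divide_le_eq)
      then have "L * (1 / 2) \<le> L * (1 - K / T)" using Lpos by (intro mult_left_mono) auto
      then show ?thesis by (simp add: b_eq)
    qed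
    \<comment> \<open>From \<open>r1\<close> on, the minimum modulus hypothesis supplies the point,
      and the exponent \<open>1 - K / ln s\<close> is nonnegative. On smaller circles every value is
      at most \<open>max_mod f r1\<close>.\<close>
    have circles: "\<exists>w. norm w = s \<and> norm (f w) \<le> exp b" if s: "0 \<le> s" "s \<le> r" for s
    proof (cases "s \<ge> r1")
      case True
      then have s1: "s > 1" "s \<ge> r0" using r1(1) r0 by auto
      obtain w where w: "norm w = s" "norm (f w) = min_mod f s"
        using min_mod_attained[OF cont, of s] s1 by auto
      have "K \<le> ln s"
      proof -
        have "K = ln (exp K)" by simp
        also have "\<dots> \<le> ln s" by (subst ln_le_cancel_iff) (use True r1(3) s1 in auto)
        finally show ?thesis .
      qed
      then have lns: "K / ln s \<le> 1" using Kpos by (simp add: divide_le_eq)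
      have "norm (f w) \<le> max_mod f s powr (1 - K / ln s)" using small s1 w(2) by simp
      also have "\<dots> \<le> max_mod f (4 * r) powr (1 - K / ln s)"
        using lns max_mod_mono[OF hol, of s "4 * r"] s s1 M1[OF True] by (intro powr_mono2) auto
      \<comment> \<open>The exponent increases with the radius, so its value at \<open>4 * r\<close>
        serves all circles at once.\<close>
      also have "\<dots> \<le> max_mod f (4 * r) powr (1 - K / T)"
      proof (rule powr_mono[OF _ M4])
        have "ln s \<le> T" unfolding T_def by (subst ln_le_cancel_iff) (use s s1 rpos in auto)
        then have "K / T \<le> K / ln s" using Kpos s1 Tpos by (intro divide_left_mono) auto
        then show "1 - K / ln s \<le> 1 - K / T" by simp
      qed
      finally show ?thesis using w(1) expb by auto
    next
      case False
      have "norm (f (of_real s)) \<le> max_mod f r1"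
        by (rule max_mod_bound[OF hol]) (use s False in auto)
      also have "\<dots> \<le> exp b"
      proof -
        have m1: "max_mod f r1 \<ge> 1" by (rule M1) simp
        have "2 * ln (max_mod f r1) = ln ((max_mod f r1)\<^sup>2)" using m1 by (simp add: ln_realpow)
        also have "\<dots> \<le> T" unfolding T_def
          by (subst ln_le_cancel_iff) (use r(3) rpos m1 in auto)
        also have "\<dots> \<le> L" using LT Tpos by linarith
        finally have "ln (max_mod f r1) \<le> b" using b_half by linarith
        then have "exp (ln (max_mod f r1)) \<le> exp b" by (simp only: exp_le_cancel_iff)
        then show ?thesis using m1 by simp
      qed
      finally show ?thesis using s by (intro exI[of _ "of_real s"]) auto
    qed
    obtain z where z: "norm z = r" "norm (f z) = max_mod f r"
      using max_mod_attained[OF cont, of r] rpos by auto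
    have "norm (f z) \<le> 8 ^ n * exp b + 4 / 3 * exp (b + x) * sqrt (3 / 16) ^ n"
    proof (rule norm_le_if_small_on_circles[OF _ _ n(1) circles _ z(1)])
      show "f holomorphic_on cball 0 (4 * r)" using hol holomorphic_on_subset by blast
      show "norm (f w) \<le> exp (b + x)" if "norm w = 4 * r" for w
        using max_mod_bound[OF hol, of w "4 * r"] that by (simp add: b_def expL)
    qed (use rpos in auto)
    then have "max_mod f r \<le> 5 * exp (b + 5 / 7 * x)" using n(2) z(2) by linarith
    then have "ln (max_mod f r) \<le> ln (5 * exp (b + 5 / 7 * x))"
      using M1[OF r(1)] by (subst ln_le_cancel_iff) auto
    then have main: "ln (max_mod f r) \<le> ln 5 + L - 2 / 7 * x" by (simp add: ln_mult b_def)
    \<comment> \<open>This absorbs \<open>ln 5\<close> into \<open>x / 56\<close>. What remains of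
      the saving is 2/7 - 1/56 = 15/56 of \<open>x\<close>, and \<open>K = 4 * ln 4\<close> turns
      15/56 into 15/14.\<close>
    have "ln (5 ^ 14 :: real) \<le> ln (4 ^ 20)" by (subst ln_le_cancel_iff) simp_all
    then have "14 * ln (5::real) \<le> 20 * ln 4" unfolding ln_realpow by simp
    then have "ln 5 \<le> x / 56" using x20 unfolding K by linarith
    then have "ln (max_mod f r) \<le> L - 15 / 56 * x" using main by linarith
    also have "\<dots> = L * (1 - 15 / 14 * ln 4 / T)" by (simp add: x_def K algebra_simps)
    finally show ?thesis by (simp add: L_def T_def)
  qed
  then show ?thesis by (auto simp: eventually_at_top_linorder)
qed

section \<open>Power growth in logarithmic coordinates\<close>

text \<open>This is Bernoulli's inequality, obtained from the weighted mean inequality for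
  \<open>1 - c * y\<close> and 1 with weights \<open>1 / c\<close> and
  \<open>1 - 1 / c\<close>.\<close>

lemma powr_one_minus_ge:
  fixes y c :: real
  assumes "c \<ge> 1" "c * y < 1"
  shows "1 - c * y \<le> (1 - y) powr c"
proof -
  have "(1 - c * y) powr (1 / c) * 1 powr (1 - 1 / c) \<le> 1 / c * (1 - c * y) + (1 - 1 / c) * 1"
    using assms by (intro Youngs_inequality_0) auto
  also have "\<dots> = 1 - y" using assms(1) by (simp add: field_simps)
  finally have "(1 - c * y) powr (1 / c) \<le> 1 - y" by simp
  then have "((1 - c * y) powr (1 / c)) powr c \<le> (1 - y) powr c"
    using assms(1) by (intro powr_mono2) auto
  then show ?thesis using assms by (simp add: powr_powr)
qed

text \<open>Bernoulli's inequality turns \<open>step\<close> into the statement that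
  \<open>\<phi> s / s powr c\<close> does not decrease when \<open>s\<close> grows by
  \<open>C\<close>. Iterating this telescopes.\<close>

lemma power_growth_of_step:
  fixes \<phi> :: "real \<Rightarrow> real"
  assumes mono: "\<And>s t. t1 \<le> s \<Longrightarrow> s \<le> t \<Longrightarrow> \<phi> s \<le> \<phi> t"
    and pos: "\<And>t. t1 \<le> t \<Longrightarrow> 0 < \<phi> t"
    and C: "C > 0" and c: "c \<ge> 1"
    and step: "\<And>t. t1 \<le> t \<Longrightarrow> \<phi> t \<le> \<phi> (t + C) * (1 - c * C / (t + C))"
    and t: "t \<ge> t1" "t \<ge> C" and l: "l \<ge> 2"
  shows "(l - 1) powr c * \<phi> t \<le> \<phi> (l * t)"
proof -
  have tpos: "t > 0" using t(2) C by linarith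
  have one: "\<phi> s * ((s + C) / s) powr c \<le> \<phi> (s + C)" if s: "s \<ge> t" for s
  proof -
    have spos: "s > 0" "s \<ge> t1" using s t tpos by auto
    \<comment> \<open>Positivity of \<open>\<phi>\<close> forces \<open>c * C < s + C\<close>, the
      side condition of Bernoulli's inequality.\<close>
    have "0 < \<phi> (s + C) * (1 - c * C / (s + C))" using step[OF spos(2)] pos[OF spos(2)] by linarith
    moreover have "0 < \<phi> (s + C)" using pos[of "s + C"] spos C by linarith
    ultimately have "c * (C / (s + C)) < 1" by (simp add: zero_less_mult_iff)
    then have "1 - c * (C / (s + C)) \<le> (1 - C / (s + C)) powr c" by (rule powr_one_minus_ge[OF c])
    moreover have "1 - C / (s + C) = s / (s + C)" using spos C by (simp add: field_simps)
    ultimately have "\<phi> s \<le> \<phi> (s + C) * (s / (s + C)) powr c"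
      using step[OF spos(2)] \<open>0 < \<phi> (s + C)\<close>
      by (metis mult_left_mono less_imp_le order_trans times_divide_eq_right)
    then have "\<phi> s * ((s + C) / s) powr c \<le> (\<phi> (s + C) * (s / (s + C)) powr c) * ((s + C) / s) powr c"
      by (intro mult_right_mono) auto
    also have "\<dots> = \<phi> (s + C) * (s / (s + C) * ((s + C) / s)) powr c"
      using spos C by (simp only: powr_mult mult.assoc)
    also have "\<dots> = \<phi> (s + C)" using spos C by simp
    finally show ?thesis .
  qed
  have iter: "\<phi> t * ((t + real k * C) / t) powr c \<le> \<phi> (t + real k * C)" for k
  proof (induction k)
    case 0
    then show ?case using tpos by simp
  next
    case (Suc k)
    define s where "s = t + real k * C"
    have s: "s \<ge> t" "s > 0" using C tpos by (auto simp: s_def intro: add_pos_nonneg)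
    have sC: "t + real (Suc k) * C = s + C" by (simp add: s_def algebra_simps)
    have "((s + C) / t) powr c = (s / t * ((s + C) / s)) powr c" using s by simp
    also have "\<dots> = (s / t) powr c * ((s + C) / s) powr c" by (rule powr_mult)
    finally have "\<phi> t * ((s + C) / t) powr c = (\<phi> t * (s / t) powr c) * ((s + C) / s) powr c"
      by simp
    also have "\<dots> \<le> \<phi> s * ((s + C) / s) powr c"
      using Suc unfolding s_def[symmetric] by (intro mult_right_mono) auto
    also have "\<dots> \<le> \<phi> (s + C)" by (rule one[OF s(1)])
    finally show ?case unfolding sC .
  qed
  \<comment> \<open>As many steps as fit between \<open>t\<close> and \<open>l * t\<close>. The
    remainder is below \<open>C <= t\<close>, which is why \<open>l - 1\<close> replaces
    \<open>l\<close> in the bound.\<close>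
  define k where "k = nat \<lfloor>(l - 1) * t / C\<rfloor>"
  have "(l - 1) * t / C \<ge> 0" using l tpos C by simp
  then have k: "real k \<le> (l - 1) * t / C" "(l - 1) * t / C < real k + 1"
    unfolding k_def by linarith+
  have k_up: "t + real k * C \<le> l * t" using k(1) C by (simp add: le_divide_eq algebra_simps)
  have "(l - 1) * t \<le> t + real k * C" using k(2) C t(2) by (simp add: divide_less_eq algebra_simps)
  then have k_low: "l - 1 \<le> (t + real k * C) / t" using tpos by (simp add: le_divide_eq)
  have "(l - 1) powr c * \<phi> t \<le> ((t + real k * C) / t) powr c * \<phi> t"
    using k_low l c pos[OF t(1)] by (intro mult_right_mono powr_mono2) auto
  also have "\<dots> \<le> \<phi> (t + real k * C)" using iter[of k] by (simp add: mult.commute)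
  also have "\<dots> \<le> \<phi> (l * t)" using k_up t C by (intro mono) (auto intro: add_increasing2)
  finally show ?thesis .
qed

lemma mu_mono:
  assumes "f holomorphic_on UNIV" "0 \<le> r" "r \<le> s" "0 < \<epsilon>"
  shows "mu f \<epsilon> r \<le> mu f \<epsilon> s"
  unfolding mu_def using assms by (intro powr_mono2 max_mod_mono max_mod_nonneg) auto

text \<open>With \<open>t = ln r\<close> the last conclusion reads
  \<open>l * \<phi> t <= \<epsilon> * \<phi> (l * t)\<close>. As the growth exponent
  \<open>c\<close> exceeds 1, \<open>(l - 1) powr c\<close> outgrows
  \<open>l / \<epsilon>\<close>.\<close>

lemma mu_ge_powr_scaling:
  assumes f: "transcendental_entire f" and K: "K = 4 * ln 4" and r0: "r0 > 1"
    and small: "\<forall>r\<ge>r0. min_mod f r \<le> max_mod f r powr (1 - K / ln r)"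
    and \<epsilon>: "0 < \<epsilon>" "\<epsilon> < 1"
  obtains l R1 where "l \<ge> 1" "R1 > 0"
    "\<And>r. r \<ge> R1 \<Longrightarrow> max_mod f r powr l \<le> mu f \<epsilon> (r powr l)"
proof -
  have hol: "f holomorphic_on UNIV" using f by (simp add: transcendental_entire_def)
  obtain a where a: "\<And>r. r \<ge> a \<Longrightarrow> r powr 1 \<le> max_mod f r"
    "\<And>r. r \<ge> a \<Longrightarrow> ln (max_mod f r) \<le> ln (max_mod f (4 * r)) * (1 - 15 / 14 * ln 4 / ln (4 * r))"
    using eventually_conj[OF eventually_max_mod_ge_powr[OF f, of 1] ln_max_mod_step[OF f K r0 small]]
    by (auto simp: eventually_at_top_linorder)
  define t1 where "t1 = max 1 (ln (max a 1))"
  have exp_t1: "exp t \<ge> a" "exp t > 1" if "t \<ge> t1" for t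
  proof -
    have "max a 1 \<le> exp (ln (max a 1))" by simp
    also have "\<dots> \<le> exp t" using that unfolding t1_def exp_le_cancel_iff by linarith
    finally show "exp t \<ge> a" by simp
    show "exp t > 1" using that unfolding t1_def by simp
  qed
  define \<phi> where "\<phi> t = ln (max_mod f (exp t))" for t
  have M: "max_mod f (exp t) > 1" if "t \<ge> t1" for t
    using a(1)[OF exp_t1(1)[OF that]] exp_t1(2)[OF that]
    unfolding powr_one[OF exp_ge_zero] by linarith
  define c :: real where "c = 15 / 14"
  have growth: "(l - 1) powr c * \<phi> t \<le> \<phi> (l * t)" if "t \<ge> t1" "t \<ge> ln 4" "l \<ge> 2" for l t
  proof (rule power_growth_of_step[where C = "ln 4" and ?t1.0 = t1])
    show "\<phi> s \<le> \<phi> t" if "t1 \<le> s" "s \<le> t" for s t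
      unfolding \<phi>_def using M[OF that(1)] that max_mod_mono[OF hol, of "exp s" "exp t"]
      by (subst ln_le_cancel_iff) auto
    show "0 < \<phi> t" if "t1 \<le> t" for t unfolding \<phi>_def using M[OF that] by simp
    show "\<phi> t \<le> \<phi> (t + ln 4) * (1 - c * ln 4 / (t + ln 4))" if "t1 \<le> t" for t
      using a(2)[OF exp_t1(1)[OF that]] by (simp add: \<phi>_def c_def exp_add ln_mult mult.commute add.commute)
  qed (use that in \<open>auto simp: c_def\<close>)
  \<comment> \<open>Chosen so that \<open>(l - 1) powr (c - 1) = 2 / \<epsilon>\<close>; then
    \<open>\<epsilon> * (l - 1) powr c = 2 * (l - 1)\<close>, which is at least \<open>l\<close>
    because \<open>l >= 2\<close>.\<close>
  define l where "l = 1 + (2 / \<epsilon>) powr (1 / (c - 1))"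
  have "(2 / \<epsilon>) powr (1 / (c - 1)) \<ge> 1"
    using \<epsilon> by (intro ge_one_powr_ge_zero) (auto simp: c_def le_divide_eq)
  then have l2: "l \<ge> 2" by (simp add: l_def)
  have l_eps: "\<epsilon> * (l - 1) powr c \<ge> l"
  proof -
    have "(l - 1) powr c = (l - 1) powr (c - 1) * (l - 1) powr 1"
      by (simp only: powr_add[symmetric]) simp
    also have "(l - 1) powr (c - 1) = 2 / \<epsilon>"
    proof -
      have "1 / (c - 1) * (c - 1) = 1" by (simp add: c_def)
      then show ?thesis using \<epsilon> by (simp only: l_def powr_powr add_diff_cancel_left') simp
    qed
    finally have eq: "\<epsilon> * (l - 1) powr c = 2 * (l - 1)" using \<epsilon> l2 by simp
    show ?thesis unfolding eq using l2 by simp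
  qed
  define R1 where "R1 = exp (max t1 (ln 4))"
  show thesis
  proof (rule that[of l R1])
    show "l \<ge> 1" using l2 by simp
    show "R1 > 0" by (simp add: R1_def)
    fix r assume r: "r \<ge> R1"
    define t where "t = ln r"
    have rpos: "r > 0" using r unfolding R1_def by (rule less_le_trans[OF exp_gt_zero])
    have "max t1 (ln 4) = ln R1" by (simp add: R1_def)
    also have "\<dots> \<le> t" unfolding t_def using r rpos by (subst ln_le_cancel_iff) (auto simp: R1_def)
    finally have t: "t \<ge> t1" "t \<ge> ln 4" by auto
    have rt: "exp t = r" using rpos by (simp add: t_def)
    have "t \<ge> 0" using t(1) unfolding t1_def by simp
    then have "t \<le> l * t" using l2 by (simp add: mult_le_cancel_right1)
    then have Ml: "max_mod f (exp (l * t)) > 1" using M t(1) by simp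
    have "0 < \<phi> t" unfolding \<phi>_def using M[OF t(1)] by simp
    then have "l * \<phi> t \<le> (\<epsilon> * (l - 1) powr c) * \<phi> t" using l_eps by (intro mult_right_mono) auto
    also have "\<dots> \<le> \<epsilon> * \<phi> (l * t)" using growth[OF t l2] \<epsilon> by (simp add: mult.assoc)
    finally have "exp (l * \<phi> t) \<le> exp (\<epsilon> * \<phi> (l * t))" by simp
    then show "max_mod f r powr l \<le> mu f \<epsilon> (r powr l)"
      using M[OF t(1)] Ml rpos unfolding \<phi>_def mu_def rt by (simp add: powr_def t_def)
  qed
qed

section \<open>Comparison of iterates and weak regularity\<close>

lemma admissible_funpow_ge:
  assumes "admissible g R"
  shows "(g ^^ n) R \<ge> R"
proof (induction n)
  case (Suc n)
  then show ?case using assms by (force simp: admissible_def)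
qed simp

text \<open>The floor \<open>c\<close>, preserved by \<open>g\<close>, restricts the comparison to
  arguments above it. With \<open>g = h\<close> this is monotonicity of iterates; with different
  functions it compares \<open>mu\<close> with \<open>max_mod\<close>.\<close>

lemma funpow_le_funpow:
  fixes g h :: "real \<Rightarrow> real"
  assumes "\<And>x y. c \<le> x \<Longrightarrow> x \<le> y \<Longrightarrow> g x \<le> h y" and "\<And>x. c \<le> x \<Longrightarrow> c \<le> g x"
    and "c \<le> a" "a \<le> b"
  shows "(g ^^ n) a \<le> (h ^^ n) b"
proof -
  have "c \<le> (g ^^ n) a \<and> (g ^^ n) a \<le> (h ^^ n) b"
    using assms by (induction n) auto
  then show ?thesis by simp
qed

text \<open>The map \<open>x powr l\<close> carries orbits of \<open>max_mod f\<close> below orbits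
  of \<open>mu f \<epsilon>\<close>, so \<open>R2 powr l\<close> is a witness for
  regularity.\<close>

lemma weakly_regular_if_small_min_mod:
  assumes f: "transcendental_entire f" and K: "K = 4 * ln 4" and r0: "r0 > 1"
    and small: "\<forall>r\<ge>r0. min_mod f r \<le> max_mod f r powr (1 - K / ln r)"
    and R: "admissible (max_mod f) R"
  shows "weakly_regular f R"
  unfolding weakly_regular_def
proof
  fix \<epsilon> :: real assume \<epsilon>: "\<epsilon> \<in> {0<..<1}"
  have hol: "f holomorphic_on UNIV" using f by (simp add: transcendental_entire_def)
  obtain l R1 where l: "l \<ge> 1" "R1 > 0"
    "\<And>r. r \<ge> R1 \<Longrightarrow> max_mod f r powr l \<le> mu f \<epsilon> (r powr l)"
    using mu_ge_powr_scaling[OF f K r0 small, of \<epsilon>] \<epsilon> by auto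
  define R2 where "R2 = Max {R, R1, 1}"
  have R2: "R2 \<ge> R" "R2 \<ge> R1" "R2 \<ge> 1" by (auto simp: R2_def)
  have adm: "admissible (max_mod f) R2" using R R2 by (auto simp: admissible_def)
  have iter: "(max_mod f ^^ n) R2 powr l \<le> (mu f \<epsilon> ^^ n) (R2 powr l)" for n
  proof (induction n)
    case (Suc n)
    let ?x = "(max_mod f ^^ n) R2"
    have "?x \<ge> R1" using admissible_funpow_ge[OF adm, of n] R2(2) by linarith
    then have "max_mod f ?x powr l \<le> mu f \<epsilon> (?x powr l)" by (rule l(3))
    also have "\<dots> \<le> mu f \<epsilon> ((mu f \<epsilon> ^^ n) (R2 powr l))"
      using Suc \<epsilon> by (intro mu_mono[OF hol]) auto
    finally show ?case by simp
  qed simp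
  have "(max_mod f ^^ n) R \<le> (mu f \<epsilon> ^^ n) (R2 powr l)" for n
  proof -
    have "(max_mod f ^^ n) R \<le> (max_mod f ^^ n) R2"
      by (rule funpow_le_funpow[where c = 0])
        (use R R2 max_mod_mono[OF hol] max_mod_nonneg[OF hol] in \<open>auto simp: admissible_def\<close>)
    also have "\<dots> = (max_mod f ^^ n) R2 powr 1"
      using admissible_funpow_ge[OF adm, of n] R2(3) by simp
    also have "\<dots> \<le> (max_mod f ^^ n) R2 powr l"
      using admissible_funpow_ge[OF adm, of n] R2(3) l(1) by (intro powr_mono) auto
    also have "\<dots> \<le> (mu f \<epsilon> ^^ n) (R2 powr l)" by (rule iter)
    finally show ?thesis .
  qed
  moreover have "R2 powr l > 0" using R2(3) by simp
  ultimately show "eps_regular f \<epsilon> R" unfolding eps_regular_def by blast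
qed

section \<open>Unboundedness of iterates from admissible radii\<close>

text \<open>A maximum point on the circle of radius \<open>L\<close> is moved radially inward:
  \<open>f\<close> stays large there by continuity.\<close>

lemma max_mod_lower_semicontinuous:
  assumes hol: "f holomorphic_on UNIV" and L: "L > 0" and a: "a < max_mod f L"
  obtains d where "d < L" "\<And>s. d < s \<Longrightarrow> s \<le> L \<Longrightarrow> a < max_mod f s"
proof -
  have cont: "continuous_on UNIV f" using hol by (rule holomorphic_on_imp_continuous_on)
  obtain z where z: "norm z = L" "norm (f z) = max_mod f L" using max_mod_attained[OF cont L] by auto
  define h where "h s = norm (f (of_real (s / L) * z))" for s
  have "continuous_on UNIV h"
    unfolding h_def using L by (intro continuous_intros continuous_on_compose2[OF cont]) auto
  then have "(h \<longlongrightarrow> h L) (at_left L)"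
    by (auto simp: continuous_on_eq_continuous_within continuous_within intro: filterlim_at_split[THEN iffD1, THEN conjunct1])
  moreover have hL: "a < h L" using a z L by (simp add: h_def)
  ultimately have "eventually (\<lambda>s. a < h s) (at_left L)" by (rule order_tendstoD)
  then obtain d where d: "d < L" "\<And>s. d < s \<Longrightarrow> s < L \<Longrightarrow> a < h s"
    by (auto simp: eventually_at_left_field)
  show thesis
  proof (rule that[of "max d 0"])
    show "max d 0 < L" using d L by simp
    fix s assume s: "max d 0 < s" "s \<le> L"
    then have "a < h s" using d(2)[of s] hL by (cases "s = L") auto
    also have "h s \<le> max_mod f s"
      unfolding h_def using s L z by (intro max_mod_bound[OF hol]) (simp add: norm_mult norm_divide)
    finally show "a < max_mod f s" .
  qed
qed

text \<open>Bounded iterates would increase to a limit \<open>L\<close> with \<open>L < g L\<close>.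
  By \<open>lsc\<close> some iterate near \<open>L\<close> is then mapped beyond \<open>L\<close>,
  although its image is again an iterate.\<close>

lemma admissible_funpow_unbounded:
  assumes adm: "admissible g R"
    and lsc: "\<And>L. L \<ge> R \<Longrightarrow> L < g L \<Longrightarrow> \<exists>d<L. \<forall>s. d < s \<and> s \<le> L \<longrightarrow> L < g s"
  shows "\<exists>k. B \<le> (g ^^ k) R"
proof (rule ccontr)
  assume "\<not> ?thesis"
  then have bdd: "(g ^^ k) R \<le> B" for k by (simp add: not_le less_imp_le)
  define x where "x k = (g ^^ k) R" for k
  have ge: "x k \<ge> R" for k unfolding x_def by (rule admissible_funpow_ge[OF adm])
  have less: "x k < x (Suc k)" for k using adm ge[of k] by (simp add: admissible_def x_def)
  then have inc: "incseq x" by (intro incseq_SucI less_imp_le)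
  then obtain L where L: "x \<longlonglongrightarrow> L" "\<And>k. x k \<le> L"
    using incseq_convergent[OF inc, of B] bdd unfolding x_def by blast
  have LR: "L \<ge> R" using L(2)[of 0] ge[of 0] by linarith
  then have "L < g L" using adm by (simp add: admissible_def)
  then obtain d where d: "d < L" "\<And>s. d < s \<Longrightarrow> s \<le> L \<Longrightarrow> L < g s" using lsc[OF LR] by blast
  have "eventually (\<lambda>k. d < x k) sequentially" using L(1) d(1) by (rule order_tendstoD)
  then obtain k where "d < x k" by (auto simp: eventually_sequentially)
  then have "L < g (x k)" using d(2) L(2) by blast
  then show False using L(2)[of "Suc k"] by (simp add: x_def)
qed

lemma max_mod_funpow_unbounded:
  assumes hol: "f holomorphic_on UNIV" and adm: "admissible (max_mod f) R"
  shows "\<exists>k. B \<le> (max_mod f ^^ k) R"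
proof (rule admissible_funpow_unbounded[OF adm])
  fix L assume "L \<ge> R" "L < max_mod f L"
  moreover have "R > 0" using adm by (simp add: admissible_def)
  ultimately obtain d where "d < L" "\<And>s. d < s \<Longrightarrow> s \<le> L \<Longrightarrow> L < max_mod f s"
    using max_mod_lower_semicontinuous[OF hol, of L L] by auto
  then show "\<exists>d<L. \<forall>s. d < s \<and> s \<le> L \<longrightarrow> L < max_mod f s" by blast
qed

lemma mu_funpow_unbounded:
  assumes hol: "f holomorphic_on UNIV" and \<epsilon>: "\<epsilon> > 0" and adm: "admissible (mu f \<epsilon>) R"
  shows "\<exists>k. B \<le> (mu f \<epsilon> ^^ k) R"
proof (rule admissible_funpow_unbounded[OF adm])
  fix L assume L: "L \<ge> R" "L < mu f \<epsilon> L"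
  have Lpos: "L > 0" using adm L(1) by (simp add: admissible_def)
  \<comment> \<open>This transfers the semicontinuity of \<open>max_mod\<close> to
    \<open>mu\<close>.\<close>
  have root: "L powr (1 / \<epsilon>) < max_mod f s \<longleftrightarrow> L < mu f \<epsilon> s" if "s \<ge> 0" for s
  proof -
    have "(L powr (1 / \<epsilon>)) powr \<epsilon> = L" using Lpos \<epsilon> by (simp add: powr_powr)
    then show ?thesis
      unfolding mu_def using max_mod_nonneg[OF hol that] \<epsilon>
      by (metis powr_ge_zero powr_less_mono2 powr_mono2 not_le less_imp_le)
  qed
  obtain d where "d < L" "\<And>s. d < s \<Longrightarrow> s \<le> L \<Longrightarrow> L powr (1 / \<epsilon>) < max_mod f s"
    using max_mod_lower_semicontinuous[OF hol Lpos, of "L powr (1 / \<epsilon>)"] root[of L] L(2) Lpos by auto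
  then have "max d 0 < L \<and> (\<forall>s. max d 0 < s \<and> s \<le> L \<longrightarrow> L < mu f \<epsilon> s)"
    using root Lpos by (metis less_imp_le max_less_iff_conj)
  then show "\<exists>d<L. \<forall>s. d < s \<and> s \<le> L \<longrightarrow> L < mu f \<epsilon> s" by blast
qed

section \<open>Equality of the escaping sets\<close>

text \<open>After \<open>k\<close> iterations \<open>max_mod f\<close> carries \<open>R\<close>
  beyond \<open>S\<close>; from there its orbit dominates that of \<open>mu f \<epsilon>\<close>,
  and the delay \<open>k\<close> is absorbed into \<open>l\<close>.\<close>

lemma fast_escaping_subset_eps_fast_escaping:
  assumes hol: "f holomorphic_on UNIV" and \<epsilon>: "\<epsilon> \<in> {0<..<1}"
    and R: "admissible (max_mod f) R" and S: "admissible (mu f \<epsilon>) S"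
  shows "fast_escaping_set f R \<subseteq> eps_fast_escaping_set f \<epsilon> S"
proof
  fix z assume "z \<in> fast_escaping_set f R"
  then obtain l where l: "l \<ge> 1" "\<And>n. n \<ge> 1 \<Longrightarrow> (max_mod f ^^ n) R \<le> norm ((f ^^ (n + l)) z)"
    by (auto simp: fast_escaping_set_def)
  define c where "c = max S 1"
  have c: "S \<le> c" "1 \<le> c" "S > 0" using S by (auto simp: c_def admissible_def)
  obtain k where k: "c \<le> (max_mod f ^^ k) R" using max_mod_funpow_unbounded[OF hol R] by blast
  have mu_gt: "x < mu f \<epsilon> x" if "c \<le> x" for x using S c that by (simp add: admissible_def)
  have mu_le: "mu f \<epsilon> x \<le> max_mod f y" if "c \<le> x" "x \<le> y" for x y
  proof -
    have x: "x \<ge> 1" using c that by linarith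
    \<comment> \<open>If this failed, \<open>mu f \<epsilon> x\<close> would be at most 1, against
      \<open>mu f \<epsilon> x > x >= 1\<close>; the floor \<open>c\<close> includes 1 for this
      purpose. Above 1, the power \<open>\<epsilon> < 1\<close> does not increase values.\<close>
    have "max_mod f x > 1"
    proof (rule ccontr)
      assume "\<not> ?thesis"
      then have "mu f \<epsilon> x \<le> 1"
        unfolding mu_def using max_mod_nonneg[OF hol, of x] x \<epsilon> by (intro powr_le1) auto
      then show False using mu_gt[OF that(1)] x by linarith
    qed
    then have "mu f \<epsilon> x \<le> max_mod f x powr 1"
      unfolding mu_def using \<epsilon> by (intro powr_mono) auto
    also have "\<dots> = max_mod f x" using \<open>max_mod f x > 1\<close> by simp
    also have "\<dots> \<le> max_mod f y" using that x by (intro max_mod_mono[OF hol]) auto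
    finally show ?thesis .
  qed
  have "(mu f \<epsilon> ^^ n) S \<le> norm ((f ^^ (n + (k + l))) z)" if "n \<ge> 1" for n
  proof -
    have "(mu f \<epsilon> ^^ n) S \<le> (mu f \<epsilon> ^^ n) c"
      by (rule funpow_le_funpow[where c = 0]) (use c mu_mono[OF hol] \<epsilon> in \<open>auto simp: mu_def\<close>)
    also have "\<dots> \<le> (max_mod f ^^ n) ((max_mod f ^^ k) R)"
      by (rule funpow_le_funpow[OF mu_le _ _ k]) (use mu_gt in \<open>auto intro: less_imp_le order_trans\<close>)
    also have "\<dots> = (max_mod f ^^ (n + k)) R" by (simp add: funpow_add)
    also have "\<dots> \<le> norm ((f ^^ (n + (k + l))) z)" using l(2)[of "n + k"] that by (simp add: add.assoc)
    finally show ?thesis .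
  qed
  moreover have "k + l \<ge> 1" using l(1) by simp
  ultimately show "z \<in> eps_fast_escaping_set f \<epsilon> S" unfolding eps_fast_escaping_set_def by blast
qed

text \<open>Regularity supplies a start \<open>r\<close> whose \<open>mu\<close>-orbit dominates the
  \<open>max_mod\<close>-orbit of \<open>R\<close>. Since the \<open>mu\<close>-orbit of
  \<open>S\<close> passes \<open>r\<close> after some \<open>k\<close> iterations, increasing
  \<open>l\<close> by \<open>k\<close> suffices.\<close>

lemma eps_fast_escaping_subset_fast_escaping:
  assumes hol: "f holomorphic_on UNIV" and \<epsilon>: "\<epsilon> > 0"
    and reg: "eps_regular f \<epsilon> R" and S: "admissible (mu f \<epsilon>) S"
  shows "eps_fast_escaping_set f \<epsilon> S \<subseteq> fast_escaping_set f R"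
proof
  fix z assume "z \<in> eps_fast_escaping_set f \<epsilon> S"
  then obtain l where l: "l \<ge> 1" "\<And>n. n \<ge> 1 \<Longrightarrow> (mu f \<epsilon> ^^ n) S \<le> norm ((f ^^ (n + l)) z)"
    by (auto simp: eps_fast_escaping_set_def)
  obtain r where r: "r > 0" "\<And>n. n \<ge> 1 \<Longrightarrow> (max_mod f ^^ n) R \<le> (mu f \<epsilon> ^^ n) r"
    using reg by (auto simp: eps_regular_def)
  obtain k where k: "r \<le> (mu f \<epsilon> ^^ k) S" using mu_funpow_unbounded[OF hol \<epsilon> S] by blast
  have "(max_mod f ^^ n) R \<le> norm ((f ^^ (n + (k + l))) z)" if n: "n \<ge> 1" for n
  proof -
    have "(max_mod f ^^ n) R \<le> (mu f \<epsilon> ^^ n) r" by (rule r(2)[OF n])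
    also have "\<dots> \<le> (mu f \<epsilon> ^^ n) ((mu f \<epsilon> ^^ k) S)"
      by (rule funpow_le_funpow[where c = 0]) (use k r(1) mu_mono[OF hol] \<epsilon> in \<open>auto simp: mu_def\<close>)
    also have "\<dots> = (mu f \<epsilon> ^^ (n + k)) S" by (simp add: funpow_add)
    also have "\<dots> \<le> norm ((f ^^ (n + (k + l))) z)" using l(2)[of "n + k"] n by (simp add: add.assoc)
    finally show ?thesis .
  qed
  moreover have "k + l \<ge> 1" using l(1) by simp
  ultimately show "z \<in> fast_escaping_set f R" unfolding fast_escaping_set_def by blast
qed

theorem theorem1p3:
  fixes f :: "complex \<Rightarrow> complex" and r0 K :: real
  assumes "transcendental_entire f"
    and "K = 4 * ln 4"
    and "r0 > 1"
    and "\<forall>r\<ge>r0. min_mod f r \<le> max_mod f r powr (1 - K / ln r)"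
  shows "(\<forall>R. admissible (max_mod f) R \<longrightarrow> weakly_regular f R) \<and>
         (\<forall>R S. admissible (max_mod f) R \<longrightarrow>
                (\<forall>\<epsilon>\<in>{0<..<1}. admissible (mu f \<epsilon>) (S \<epsilon>)) \<longrightarrow>
                quite_fast_escaping_set f S = fast_escaping_set f R)"
proof (intro conjI allI impI)
  show reg: "weakly_regular f R" if "admissible (max_mod f) R" for R
    using weakly_regular_if_small_min_mod[OF assms that] .
  fix R S
  assume R: "admissible (max_mod f) R" and S: "\<forall>\<epsilon>\<in>{0<..<1}. admissible (mu f \<epsilon>) (S \<epsilon>)"
  have hol: "f holomorphic_on UNIV" using assms(1) by (simp add: transcendental_entire_def)
  show "quite_fast_escaping_set f S = fast_escaping_set f R"
  proof
    show "quite_fast_escaping_set f S \<subseteq> fast_escaping_set f R"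
      unfolding quite_fast_escaping_set_def
      using reg[OF R] S by (intro UN_least eps_fast_escaping_subset_fast_escaping[OF hol])
        (auto simp: weakly_regular_def)
    have "fast_escaping_set f R \<subseteq> eps_fast_escaping_set f (1 / 2) (S (1 / 2))"
      using S by (intro fast_escaping_subset_eps_fast_escaping[OF hol _ R]) auto
    also have "\<dots> \<subseteq> quite_fast_escaping_set f S" unfolding quite_fast_escaping_set_def by force
    finally show "fast_escaping_set f R \<subseteq> quite_fast_escaping_set f S" .
  qed
qed

end
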